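(* Let $T_1,T_2\in\mathcal{B}_A(\mathcal{H})$ and let $i$ denote the imaginary unit when it multiplies an operator. Then $$w_{\mathbb{A}}\left(\begin{bmatrix}T_1&T_2\\ T_2&-iT_1\end{bmatrix}\right)\le w_A(T_1)+w_A(T_2).$$
   Context: $\mathcal{H}$ is a complex Hilbert space with inner product $\langle\cdot,\cdot\rangle$, $\mathcal{B}(\mathcal{H})$ is the algebra of bounded linear operators on $\mathcal{H}$, and $A\in\mathcal{B}(\mathcal{H})$ is a fixed positive operator ($\langle Ax,x\rangle\ge 0$ for all $x$). Put $\langle x,y\rangle_A=\langle Ax,y\rangle$ and $\|x\|_A=\sqrt{\langle x,x\rangle_A}$. $\mathcal{B}_A(\mathcal{H})$ is the set of $T\in\mathcal{B}(\mathcal{H})$ admitting an $A$-adjoint, i.e. for which there is $X\in\mathcal{B}(\mathcal{H})$ with $AX=T^*A$ (equivalently $\mathcal{R}(T^*A)\subseteq\mathcal{R}(A)$). The $A$-numerical radius is $w_A(T)=\sup\{|\langle Tx,x\rangle_A|: x\in\mathcal{H},\ \|x\|_A=1\}$. $\mathbb{A}=\begin{bmatrix}A&O\\O&A\end{bmatrix}$ on $\mathcal{H}\oplus\mathcal{H}$, and $w_{\mathbb{A}}$ is the numerical radius defined in the same way with $\mathcal{H},A$ replaced by $\mathcal{H}\oplus\mathcal{H},\mathbb{A}$. *)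

theory Defs
  imports "HOL-Analysis.Analysis"
begin

section \<open>Complex Hilbert spaces\<close>

text \<open>The inner product is linear in the first argument and conjugate linear in the second. The
  norm and the real scalar multiplication are those of the underlying real normed space, and the
  axioms tie them to the complex structure.\<close>

class complex_inner = real_normed_vector +
  fixes scaleC :: "complex \<Rightarrow> 'a \<Rightarrow> 'a" (infixr "*\<^sub>C" 75)
    and cinner :: "'a \<Rightarrow> 'a \<Rightarrow> complex"
  assumes scaleC_add_right: "c *\<^sub>C (x + y) = c *\<^sub>C x + c *\<^sub>C y"
    and scaleC_add_left: "(c + d) *\<^sub>C x = c *\<^sub>C x + d *\<^sub>C x"
    and scaleC_scaleC: "c *\<^sub>C d *\<^sub>C x = (c * d) *\<^sub>C x"
    and scaleC_of_real: "complex_of_real r *\<^sub>C x = r *\<^sub>R x"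
    and cinner_commute: "cinner x y = cnj (cinner y x)"
    and cinner_add_left: "cinner (x + y) z = cinner x z + cinner y z"
    and cinner_scaleC_left: "cinner (c *\<^sub>C x) y = c * cinner x y"
    and cinner_self: "cinner x x = complex_of_real ((norm x)\<^sup>2)"

class chilbert_space = complex_inner + complete_space

instantiation complex :: chilbert_space
begin

definition scaleC_complex :: "complex \<Rightarrow> complex \<Rightarrow> complex" where
  "scaleC_complex c x = c * x"

definition cinner_complex :: "complex \<Rightarrow> complex \<Rightarrow> complex" where
  "cinner_complex x y = x * cnj y"

instance
proof
  fix x :: complex
  show "cinner x x = complex_of_real ((norm x)\<^sup>2)"
    unfolding cinner_complex_def by (rule complex_norm_square[symmetric])
qed (simp_all add: scaleC_complex_def cinner_complex_def distrib_left distrib_right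
      scaleR_conv_of_real mult_ac)

end

text \<open>The Hilbert space direct sum: the norm of the product type is already
  \<open>sqrt ((norm x)\<^sup>2 + (norm y)\<^sup>2)\<close>.\<close>

instantiation prod :: (complex_inner, complex_inner) complex_inner
begin

definition scaleC_prod :: "complex \<Rightarrow> 'a \<times> 'b \<Rightarrow> 'a \<times> 'b" where
  "scaleC_prod c p = (c *\<^sub>C fst p, c *\<^sub>C snd p)"

definition cinner_prod :: "'a \<times> 'b \<Rightarrow> 'a \<times> 'b \<Rightarrow> complex" where
  "cinner_prod p q = cinner (fst p) (fst q) + cinner (snd p) (snd q)"

instance
proof
  fix p q r :: "'a \<times> 'b" and c d :: complex and s :: real
  show "c *\<^sub>C (p + q) = c *\<^sub>C p + c *\<^sub>C q"
    by (simp add: scaleC_prod_def scaleC_add_right)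
  show "(c + d) *\<^sub>C p = c *\<^sub>C p + d *\<^sub>C p"
    by (simp add: scaleC_prod_def scaleC_add_left)
  show "c *\<^sub>C d *\<^sub>C p = (c * d) *\<^sub>C p"
    by (simp add: scaleC_prod_def scaleC_scaleC)
  show "complex_of_real s *\<^sub>C p = s *\<^sub>R p"
    by (simp add: scaleC_prod_def scaleC_of_real scaleR_prod_def)
  show "cinner (p + q) r = cinner p r + cinner q r"
    by (simp add: cinner_prod_def cinner_add_left)
  show "cinner (c *\<^sub>C p) q = c * cinner p q"
    by (simp add: cinner_prod_def scaleC_prod_def cinner_scaleC_left distrib_left)
  show "cinner p p = complex_of_real ((norm p)\<^sup>2)"
    by (simp add: cinner_prod_def cinner_self norm_prod_def)
  show "cinner p q = cnj (cinner q p)"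
    unfolding cinner_prod_def complex_cnj_add
    by (simp only: cinner_commute[symmetric])
qed

end

instance prod :: (chilbert_space, chilbert_space) chilbert_space ..

section \<open>Bounded operators and adjoints\<close>

definition bounded_clinear :: "('a::complex_inner \<Rightarrow> 'b::complex_inner) \<Rightarrow> bool" where
  "bounded_clinear T \<longleftrightarrow> bounded_linear T \<and> (\<forall>c x. T (c *\<^sub>C x) = c *\<^sub>C T x)"

definition is_cadjoint ::
  "('a::complex_inner \<Rightarrow> 'b::complex_inner) \<Rightarrow> ('b \<Rightarrow> 'a) \<Rightarrow> bool" where
  "is_cadjoint T S \<longleftrightarrow> bounded_clinear S \<and> (\<forall>x y. cinner (T x) y = cinner x (S y))"

definition cadjoint :: "('a::chilbert_space \<Rightarrow> 'b::chilbert_space) \<Rightarrow> 'b \<Rightarrow> 'a" where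
  "cadjoint T = (THE S. is_cadjoint T S)"

subsection \<open>Existence and uniqueness of the adjoint\<close>

lemma cinner_add_right: "cinner x (y + z) = cinner x y + cinner x z"
  by (metis cinner_add_left cinner_commute complex_cnj_add)

lemma cinner_scaleC_right: "cinner x (c *\<^sub>C y) = cnj c * cinner x y"
  by (metis cinner_commute cinner_scaleC_left complex_cnj_mult)

lemma cinner_diff_left: "cinner (x - y) z = cinner x z - cinner y z"
  by (metis add_diff_cancel cinner_add_left diff_add_cancel)

lemma cinner_diff_right: "cinner x (y - z) = cinner x y - cinner x z"
  by (metis add_diff_cancel cinner_add_right diff_add_cancel)

lemma norm_sq_cinner: "(norm x)\<^sup>2 = Re (cinner x x)"
  by (simp add: cinner_self)

lemma norm_diff_sq_cinner:
  "(norm (x - y))\<^sup>2 = (norm x)\<^sup>2 + (norm y)\<^sup>2 - 2 * Re (cinner x y)"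
proof -
  have "Re (cinner y x) = Re (cinner x y)"
    by (subst cinner_commute) simp
  then show ?thesis
    by (simp add: norm_sq_cinner cinner_diff_left cinner_diff_right)
qed

lemma norm_add_sq_cinner:
  "(norm (x + y))\<^sup>2 = (norm x)\<^sup>2 + (norm y)\<^sup>2 + 2 * Re (cinner x y)"
proof -
  have "Re (cinner y x) = Re (cinner x y)"
    by (subst cinner_commute) simp
  then show ?thesis
    by (simp add: norm_sq_cinner cinner_add_left cinner_add_right)
qed

lemma norm_scaleC_sq: "(norm (c *\<^sub>C x))\<^sup>2 = (cmod c)\<^sup>2 * (norm x)\<^sup>2"
proof -
  have "complex_of_real ((norm (c *\<^sub>C x))\<^sup>2) = c * cnj c * complex_of_real ((norm x)\<^sup>2)"
    by (metis cinner_self cinner_scaleC_left cinner_scaleC_right mult.assoc)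
  also have "\<dots> = complex_of_real ((cmod c)\<^sup>2 * (norm x)\<^sup>2)"
    by (metis complex_norm_square of_real_mult)
  finally show ?thesis
    using of_real_eq_iff by blast
qed

lemma norm_diff_proj_sq:
  fixes x y :: "'a::complex_inner"
  assumes "y \<noteq> 0"
  shows "(norm (x - (cinner x y / (norm y)\<^sup>2) *\<^sub>C y))\<^sup>2
    = (norm x)\<^sup>2 - (cmod (cinner x y))\<^sup>2 / (norm y)\<^sup>2"
proof -
  let ?c = "cinner x y / complex_of_real ((norm y)\<^sup>2)"
  have "cnj ?c * cinner x y = complex_of_real ((cmod (cinner x y))\<^sup>2 / (norm y)\<^sup>2)"
    by (simp add: complex_norm_square[symmetric] mult.commute del: of_real_power)
  then have "Re (cinner x (?c *\<^sub>C y)) = (cmod (cinner x y))\<^sup>2 / (norm y)\<^sup>2"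
    by (simp add: cinner_scaleC_right del: of_real_power of_real_divide)
  moreover have "(norm (?c *\<^sub>C y))\<^sup>2 = (cmod (cinner x y))\<^sup>2 / (norm y)\<^sup>2"
    unfolding norm_scaleC_sq using assms
    by (simp add: norm_divide norm_mult norm_power power_divide power2_eq_square)
  ultimately show ?thesis
    by (simp add: norm_diff_sq_cinner del: of_real_power of_real_divide)
qed

lemma cmod_cinner_le: "cmod (cinner x y) \<le> norm x * norm y"
proof (cases "y = 0")
  case True
  have "cinner x (0 :: 'a) = 0"
    by (metis cinner_diff_right diff_self)
  with True show ?thesis by simp
next
  case False
  have "0 \<le> (norm x)\<^sup>2 - (cmod (cinner x y))\<^sup>2 / (norm y)\<^sup>2"
    by (metis norm_diff_proj_sq[OF False, of x] zero_le_power2)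
  then have "(cmod (cinner x y))\<^sup>2 \<le> (norm x * norm y)\<^sup>2"
    using False by (simp add: field_simps power_mult_distrib)
  then show ?thesis
    by (rule power2_le_imp_le) simp
qed

lemma cinner_right_eqI:
  assumes "\<And>x. cinner x y = cinner x z"
  shows "y = z"
proof -
  have "(norm (y - z))\<^sup>2 = 0"
    using assms[of "y - z"] by (simp add: norm_sq_cinner cinner_diff_right)
  then show ?thesis by simp
qed

lemma cinner_riesz:
  fixes f :: "'a::chilbert_space \<Rightarrow> complex"
  assumes f: "bounded_linear f" and fC: "\<And>c x. f (c *\<^sub>C x) = c * f x"
  shows "\<exists>z. \<forall>x. f x = cinner x z"
proof (cases "\<forall>x. f x = 0")
  case True
  have "cinner x (0 :: 'a) = 0" for x
    by (metis cinner_diff_right diff_self)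
  with True show ?thesis by (intro exI[of _ 0]) simp
next
  case False
  interpret f: bounded_linear f by fact
  define K where "K = {x. f x = 1}"
  from False obtain a where "f a \<noteq> 0" by blast
  then have "inverse (f a) *\<^sub>C a \<in> K" by (simp add: K_def fC)
  then have K_ne: "K \<noteq> {}" by blast
  define d where "d = Inf ((\<lambda>x. (norm x)\<^sup>2) ` K)"
  have d_le: "d \<le> (norm x)\<^sup>2" if "x \<in> K" for x
    unfolding d_def by (rule cINF_lower) (use that in \<open>auto intro!: bdd_belowI[of _ 0]\<close>)
  have "\<exists>x\<in>K. (norm x)\<^sup>2 < d + inverse (real (Suc n))" for n
  proof -
    have "d < d + inverse (real (Suc n))" by simp
    then show ?thesis
      using cInf_lessD[of "(\<lambda>x. (norm x)\<^sup>2) ` K"] K_ne unfolding d_def by blast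
  qed
  then obtain X where XK: "\<And>n. X n \<in> K"
    and Xd: "\<And>n. (norm (X n))\<^sup>2 < d + inverse (real (Suc n))" by metis
  have dist_sq: "(norm (X m - X n))\<^sup>2 \<le> 2 * (inverse (real (Suc m)) + inverse (real (Suc n)))"
    for m n
  proof -
    have "(1/2) *\<^sub>R (X m + X n) \<in> K"
      using XK[of m] XK[of n] by (simp add: K_def f.scaleR f.add scaleR_conv_of_real)
    from d_le[OF this] have "4 * d \<le> (norm (X m + X n))\<^sup>2"
      by (simp add: power_divide)
    moreover have "(norm (X m - X n))\<^sup>2 + (norm (X m + X n))\<^sup>2
        = 2 * (norm (X m))\<^sup>2 + 2 * (norm (X n))\<^sup>2"
      by (simp add: norm_diff_sq_cinner norm_add_sq_cinner)
    moreover have "a \<le> 2 * (i + j)"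
      if "4 * d \<le> b" "a + b = 2 * p + 2 * q" "p < d + i" "q < d + j" for a b p q i j :: real
      using that by argo
    ultimately show ?thesis
      using Xd[of m] Xd[of n] by blast
  qed
  have "Cauchy X"
  proof (rule metric_CauchyI)
    fix e :: real assume "0 < e"
    then have "0 < e\<^sup>2 / 4" by simp
    then obtain M where M: "inverse (real (Suc M)) < e\<^sup>2 / 4"
      using reals_Archimedean by blast
    have "dist (X m) (X n) < e" if "m \<ge> M" "n \<ge> M" for m n
    proof -
      have "inverse (real (Suc m)) \<le> inverse (real (Suc M))"
        "inverse (real (Suc n)) \<le> inverse (real (Suc M))"
        using that by (simp_all add: le_imp_inverse_le)
      then have "(norm (X m - X n))\<^sup>2 < e\<^sup>2"
        using dist_sq[of m n] M by argo
      then show ?thesis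
        using \<open>0 < e\<close> by (simp add: dist_norm power2_less_imp_less)
    qed
    then show "\<exists>M. \<forall>m\<ge>M. \<forall>n\<ge>M. dist (X m) (X n) < e" by blast
  qed
  then obtain z where z: "X \<longlonglongrightarrow> z"
    using Cauchy_convergent convergentD by blast
  have "(\<lambda>n. f (X n)) \<longlonglongrightarrow> f z" by (rule f.tendsto[OF z])
  moreover have "(\<lambda>n. f (X n)) = (\<lambda>_. 1)" using XK by (auto simp: K_def)
  ultimately have fz: "f z = 1" by (metis LIMSEQ_unique tendsto_const)
  have "(\<lambda>n. (norm (X n))\<^sup>2) \<longlonglongrightarrow> (norm z)\<^sup>2" by (intro tendsto_intros z)
  moreover have "(\<lambda>n. d + inverse (real (Suc n))) \<longlonglongrightarrow> d + 0"
    by (intro tendsto_intros LIMSEQ_inverse_real_of_nat)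
  ultimately have zd: "(norm z)\<^sup>2 \<le> d"
    using LIMSEQ_le[of "\<lambda>n. (norm (X n))\<^sup>2" _ "\<lambda>n. d + inverse (real (Suc n))" "d + 0"] Xd
    by (simp add: less_imp_le)
  have orth: "cinner x z = 0" if "f x = 0" for x
  proof (cases "x = 0")
    case True
    then show ?thesis by (metis cinner_diff_left diff_self)
  next
    case False
    have "z - (cinner z x / (norm x)\<^sup>2) *\<^sub>C x \<in> K"
      using fz that by (simp add: K_def f.diff fC)
    from order_trans[OF zd d_le[OF this]]
    have "(cmod (cinner z x))\<^sup>2 / (norm x)\<^sup>2 \<le> 0"
      by (simp add: norm_diff_proj_sq[OF False] del: of_real_power)
    then have "cinner z x = 0" using False by (simp add: divide_le_0_iff)
    then show ?thesis by (subst cinner_commute) simp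
  qed
  have "z \<noteq> 0" using fz f.zero by auto
  have "f x = cinner x (complex_of_real (inverse ((norm z)\<^sup>2)) *\<^sub>C z)" for x
  proof -
    have "cinner (x - f x *\<^sub>C z) z = 0"
      by (rule orth) (simp add: f.diff fC fz)
    then have "cinner x z = f x * complex_of_real ((norm z)\<^sup>2)"
      by (simp add: cinner_diff_left cinner_scaleC_left cinner_self)
    then show ?thesis
      using \<open>z \<noteq> 0\<close> by (simp add: cinner_scaleC_right)
  qed
  then show ?thesis by blast
qed

lemma is_cadjoint_unique:
  assumes "is_cadjoint T S" "is_cadjoint T S'"
  shows "S = S'"
proof
  fix y
  have "cinner x (S y) = cinner x (S' y)" for x
    using assms unfolding is_cadjoint_def by metis
  then show "S y = S' y"
    by (rule cinner_right_eqI)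
qed

lemma is_cadjoint_exists:
  fixes T :: "'a::chilbert_space \<Rightarrow> 'b::chilbert_space"
  assumes "bounded_clinear T"
  shows "\<exists>S. is_cadjoint T S"
proof -
  interpret T: bounded_linear T using assms by (simp add: bounded_clinear_def)
  from T.pos_bounded obtain K where K: "0 < K" "\<And>x. norm (T x) \<le> norm x * K" by blast
  have "\<exists>z. \<forall>x. cinner (T x) y = cinner x z" for y
  proof (rule cinner_riesz)
    show "bounded_linear (\<lambda>x. cinner (T x) y)"
    proof (rule bounded_linear_intro[where K = "K * norm y"])
      show "cinner (T (r *\<^sub>R x)) y = r *\<^sub>R cinner (T x) y" for r x
        by (metis T.scaleR cinner_scaleC_left scaleC_of_real scaleR_conv_of_real)
      show "norm (cinner (T x) y) \<le> norm x * (K * norm y)" for x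
        using cmod_cinner_le[of "T x" y] mult_right_mono[OF K(2)[of x], of "norm y"]
        by (simp add: mult.assoc)
    qed (simp add: T.add cinner_add_left)
    show "cinner (T (c *\<^sub>C x)) y = c * cinner (T x) y" for c x
      using assms by (simp add: bounded_clinear_def cinner_scaleC_left)
  qed
  then obtain S where S: "\<And>x y. cinner (T x) y = cinner x (S y)" by metis
  have add: "S (y + z) = S y + S z" for y z
    by (rule cinner_right_eqI) (simp add: S[symmetric] cinner_add_right)
  have scale: "S (c *\<^sub>C y) = c *\<^sub>C S y" for c y
    by (rule cinner_right_eqI) (simp add: S[symmetric] cinner_scaleC_right)
  have "bounded_linear S"
  proof (rule bounded_linear_intro[where K = K])
    show "S (r *\<^sub>R y) = r *\<^sub>R S y" for r y
      by (metis scale scaleC_of_real)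
    show "norm (S y) \<le> norm y * K" for y
    proof (cases "S y = 0")
      case False
      have "norm (S y) * norm (S y) = cmod (cinner (T (S y)) y)"
        by (simp add: S cinner_self norm_power power2_eq_square norm_mult)
      also have "\<dots> \<le> norm (T (S y)) * norm y" by (rule cmod_cinner_le)
      also have "\<dots> \<le> norm (S y) * K * norm y" by (intro mult_right_mono K) simp
      finally have "norm (S y) * norm (S y) \<le> norm (S y) * (norm y * K)"
        by (simp only: mult_ac)
      then show ?thesis using False mult_left_le_imp_le by fastforce
    qed (use K(1) in simp)
  qed (rule add)
  with scale S show ?thesis by (auto simp: is_cadjoint_def bounded_clinear_def)
qed

lemma cadjoint: "bounded_clinear T \<Longrightarrow> is_cadjoint T (cadjoint T)"
  unfolding cadjoint_def
  using theI'[of "is_cadjoint T"] is_cadjoint_exists is_cadjoint_unique by blast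

section \<open>The semi-inner product and numerical radius induced by a positive operator\<close>

definition positive_op :: "('a::complex_inner \<Rightarrow> 'a) \<Rightarrow> bool" where
  "positive_op A \<longleftrightarrow> bounded_clinear A \<and> (\<forall>x. cinner (A x) x \<in> \<real>\<^sub>\<ge>\<^sub>0)"

definition B_A :: "('a::chilbert_space \<Rightarrow> 'a) \<Rightarrow> ('a \<Rightarrow> 'a) set" where
  "B_A A = {T. bounded_clinear T \<and> (\<exists>X. bounded_clinear X \<and> A \<circ> X = cadjoint T \<circ> A)}"

definition A_inner :: "('a::complex_inner \<Rightarrow> 'a) \<Rightarrow> 'a \<Rightarrow> 'a \<Rightarrow> complex" where
  "A_inner A x y = cinner (A x) y"

definition A_norm :: "('a::complex_inner \<Rightarrow> 'a) \<Rightarrow> 'a \<Rightarrow> real" where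
  "A_norm A x = sqrt (Re (A_inner A x x))"

text \<open>The supremum is taken in \<open>[0, \<infinity>]\<close>: it is \<open>\<infinity>\<close> if the set is unbounded (which can
  happen only for operators without an \<open>A\<close>-adjoint), and \<open>0\<close> in the degenerate case \<open>A = 0\<close>,
  where no vector satisfies \<open>A_norm A x = 1\<close>.\<close>

definition A_numerical_radius :: "('a::complex_inner \<Rightarrow> 'a) \<Rightarrow> ('a \<Rightarrow> 'a) \<Rightarrow> ennreal" where
  "A_numerical_radius A T = (SUP x\<in>{x. A_norm A x = 1}. ennreal (cmod (A_inner A (T x) x)))"

definition block_op ::
  "('a::complex_inner \<Rightarrow> 'a) \<Rightarrow> ('a \<Rightarrow> 'a) \<Rightarrow> ('a \<Rightarrow> 'a) \<Rightarrow> ('a \<Rightarrow> 'a) \<Rightarrow> 'a \<times> 'a \<Rightarrow> 'a \<times> 'a" where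
  "block_op P Q R S = (\<lambda>(x, y). (P x + Q y, R x + S y))"

end

theory Submission
  imports Defs
begin

text \<open>The bound is proved separately for the diagonal and the off-diagonal part of the block
  operator, starting from \<open>\<bar>\<langle>Tx, x\<rangle>\<^sub>A\<bar> \<le> w\<^sub>A(T) \<parallel>x\<parallel>\<^sub>A\<^sup>2\<close> for every vector \<open>x\<close>
  (lemma \<open>A_numerical_radius_bound\<close>).

  At a vector \<open>(x, y)\<close> with \<open>\<parallel>x\<parallel>\<^sub>A\<^sup>2 + \<parallel>y\<parallel>\<^sub>A\<^sup>2 = 1\<close> the diagonal contributes
  \<open>\<langle>T\<^sub>1x, x\<rangle>\<^sub>A - i \<langle>T\<^sub>1y, y\<rangle>\<^sub>A\<close>, which is at most \<open>w\<^sub>A(T\<^sub>1)\<close> in modulus because the factor \<open>-i\<close> is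
  unimodular. The off-diagonal contributes \<open>\<langle>T\<^sub>2y, x\<rangle>\<^sub>A + \<langle>T\<^sub>2x, y\<rangle>\<^sub>A\<close>, and polarization turns twice
  this sum into the difference of the values of the quadratic form \<open>z \<mapsto> \<langle>T\<^sub>2z, z\<rangle>\<^sub>A\<close> at \<open>x + y\<close> and
  \<open>x - y\<close>. The parallelogram law then bounds it by \<open>w\<^sub>A(T\<^sub>2)\<close>; this is lemma
  \<open>A_inner_swap_bound\<close>.

  The one delicate point is that \<open>\<parallel>\<cdot>\<parallel>\<^sub>A\<close> is only a seminorm: vectors with \<open>\<parallel>x\<parallel>\<^sub>A = 0\<close> cannot be
  normalized. For them \<open>\<langle>Tx, x\<rangle>\<^sub>A\<close> itself vanishes (lemma \<open>A_inner_null_right\<close>).\<close>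

section \<open>The semi-inner product of a positive operator\<close>

lemma bounded_clinear_add: "bounded_clinear T \<Longrightarrow> T (x + y) = T x + T y"
  by (simp add: bounded_clinear_def linear_simps)

lemma bounded_clinear_diff: "bounded_clinear T \<Longrightarrow> T (x - y) = T x - T y"
  by (simp add: bounded_clinear_def linear_simps)

lemma bounded_clinear_scaleC: "bounded_clinear T \<Longrightarrow> T (c *\<^sub>C x) = c *\<^sub>C T x"
  by (simp add: bounded_clinear_def)

lemma positive_op_bounded_clinear: "positive_op A \<Longrightarrow> bounded_clinear A"
  by (simp add: positive_op_def)

lemma B_A_bounded_clinear: "T \<in> B_A A \<Longrightarrow> bounded_clinear T"
  by (simp add: B_A_def)

lemma A_inner_add_left:
  "bounded_clinear A \<Longrightarrow> A_inner A (x + y) z = A_inner A x z + A_inner A y z"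
  by (simp add: A_inner_def bounded_clinear_add cinner_add_left)

lemma A_inner_diff_left:
  "bounded_clinear A \<Longrightarrow> A_inner A (x - y) z = A_inner A x z - A_inner A y z"
  by (simp add: A_inner_def bounded_clinear_diff cinner_diff_left)

lemma A_inner_scaleC_left:
  "bounded_clinear A \<Longrightarrow> A_inner A (c *\<^sub>C x) y = c * A_inner A x y"
  by (simp add: A_inner_def bounded_clinear_scaleC cinner_scaleC_left)

lemma A_inner_add_right: "A_inner A x (y + z) = A_inner A x y + A_inner A x z"
  by (simp add: A_inner_def cinner_add_right)

lemma A_inner_diff_right: "A_inner A x (y - z) = A_inner A x y - A_inner A x z"
  by (simp add: A_inner_def cinner_diff_right)

lemma A_inner_scaleC_right: "A_inner A x (c *\<^sub>C y) = cnj c * A_inner A x y"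
  by (simp add: A_inner_def cinner_scaleC_right)

lemma A_inner_self_nonneg: "positive_op A \<Longrightarrow> A_inner A x x \<in> \<real>\<^sub>\<ge>\<^sub>0"
  by (simp add: positive_op_def A_inner_def)

lemma A_norm_sq: "positive_op A \<Longrightarrow> (A_norm A x)\<^sup>2 = Re (A_inner A x x)"
  using A_inner_self_nonneg[of A x] by (simp add: A_norm_def complex_nonneg_Reals_iff)

lemma A_inner_self: "positive_op A \<Longrightarrow> A_inner A x x = complex_of_real ((A_norm A x)\<^sup>2)"
  using A_inner_self_nonneg[of A x]
  by (simp add: A_norm_sq complex_nonneg_Reals_iff complex_eq_iff del: of_real_power)

lemma A_norm_nonneg: "positive_op A \<Longrightarrow> 0 \<le> A_norm A x"
  using A_inner_self_nonneg[of A x] by (simp add: A_norm_def complex_nonneg_Reals_iff)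

lemma A_norm_parallelogram:
  assumes "positive_op A"
  shows "(A_norm A (x + y))\<^sup>2 + (A_norm A (x - y))\<^sup>2 = 2 * ((A_norm A x)\<^sup>2 + (A_norm A y)\<^sup>2)"
  using positive_op_bounded_clinear[OF assms]
  by (simp add: A_norm_sq[OF assms] A_inner_add_left A_inner_diff_left
      A_inner_add_right A_inner_diff_right)

lemma nonneg_Reals_line_const:
  assumes "\<And>t::real. p + complex_of_real t * z \<in> \<real>\<^sub>\<ge>\<^sub>0"
  shows "z = 0"
proof -
  have im: "Im z = 0"
    using assms[of 0] assms[of 1] by (simp add: complex_nonneg_Reals_iff)
  have re: "0 \<le> Re p + t * Re z" for t
    using assms[of t] by (simp add: complex_nonneg_Reals_iff)
  have "Re z = 0"
  proof (rule ccontr)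
    assume "Re z \<noteq> 0"
    then show False
      using re[of "- (Re p + 1) / Re z"] by simp
  qed
  with im show ?thesis by (simp add: complex_eq_iff)
qed

text \<open>The expansion of \<open>\<langle>y + cx, y + cx\<rangle>\<^sub>A \<ge> 0\<close> has no term quadratic in \<open>c\<close> when \<open>\<parallel>x\<parallel>\<^sub>A = 0\<close>, so
  it is nonnegative along every real line of values of \<open>c\<close> only if its linear terms vanish.\<close>

lemma A_inner_null_right:
  assumes A: "positive_op A" and x: "A_norm A x = 0"
  shows "A_inner A y x = 0"
proof -
  note lin = positive_op_bounded_clinear[OF A]
  have xx: "A_inner A x x = 0"
    using A_inner_self[OF A, of x] x by simp
  have expand: "A_inner A y y + (cnj c * A_inner A y x + c * A_inner A x y) \<in> \<real>\<^sub>\<ge>\<^sub>0" for c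
    using A_inner_self_nonneg[OF A, of "y + c *\<^sub>C x"]
    by (simp add: A_inner_add_left[OF lin] A_inner_scaleC_left[OF lin]
        A_inner_add_right A_inner_scaleC_right xx algebra_simps)
  \<comment> \<open>Real and purely imaginary \<open>c\<close> give the sum and the difference of the two mixed terms.\<close>
  have "A_inner A y x + A_inner A x y = 0"
    by (rule nonneg_Reals_line_const[of "A_inner A y y"])
      (use expand[of "complex_of_real _"] in \<open>simp add: algebra_simps\<close>)
  moreover have "\<i> * (A_inner A x y - A_inner A y x) = 0"
    by (rule nonneg_Reals_line_const[of "A_inner A y y"])
      (use expand[of "\<i> * complex_of_real _"] in \<open>simp add: algebra_simps\<close>)
  ultimately show ?thesis by simp
qed

section \<open>Bounds by the numerical radius\<close>

text \<open>The numerical radius is a supremum over unit vectors; homogeneity extends its defining bound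
  to all vectors of nonzero seminorm, and on the others the left-hand side is zero.\<close>

lemma A_numerical_radius_bound:
  assumes A: "positive_op A" and T: "bounded_clinear T"
  shows "ennreal (cmod (A_inner A (T x) x)) \<le> A_numerical_radius A T * ennreal ((A_norm A x)\<^sup>2)"
proof (cases "A_norm A x = 0")
  case True
  then show ?thesis by (simp add: A_inner_null_right[OF A])
next
  case False
  note lin = positive_op_bounded_clinear[OF A]
  define n where "n = A_norm A x"
  have n: "n > 0"
    using False A_norm_nonneg[OF A, of x] by (simp add: n_def)
  define z where "z = complex_of_real (1 / n) *\<^sub>C x"
  have "A_inner A z z = complex_of_real ((1 / n) * (1 / n) * n\<^sup>2)"
    by (simp add: z_def A_inner_scaleC_left[OF lin] A_inner_scaleC_right A_inner_self[OF A] n_def)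
  then have "(A_norm A z)\<^sup>2 = 1"
    using n unfolding A_norm_sq[OF A] by (simp add: power2_eq_square)
  then have "A_norm A z = 1"
    using A_norm_nonneg[OF A, of z] by (simp add: power2_eq_1_iff)
  then have le: "ennreal (cmod (A_inner A (T z) z)) \<le> A_numerical_radius A T"
    unfolding A_numerical_radius_def by (intro SUP_upper) simp
  have "cmod (A_inner A (T x) x) = cmod (A_inner A (T z) z) * n\<^sup>2"
    using n by (simp add: z_def bounded_clinear_scaleC[OF T] A_inner_scaleC_left[OF lin]
        A_inner_scaleC_right norm_mult norm_divide power2_eq_square)
  then have "ennreal (cmod (A_inner A (T x) x)) = ennreal (cmod (A_inner A (T z) z)) * ennreal (n\<^sup>2)"
    by (simp add: ennreal_mult)
  also have "\<dots> \<le> A_numerical_radius A T * ennreal (n\<^sup>2)"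
    by (intro mult_right_mono le) simp
  finally show ?thesis by (simp add: n_def)
qed

lemma A_numerical_radius_bound_pair:
  assumes A: "positive_op A" and T: "bounded_clinear T"
  shows "ennreal (cmod (A_inner A (T x) x) + cmod (A_inner A (T y) y))
    \<le> A_numerical_radius A T * ennreal ((A_norm A x)\<^sup>2 + (A_norm A y)\<^sup>2)"
  using add_mono[OF A_numerical_radius_bound[OF A T, of x] A_numerical_radius_bound[OF A T, of y]]
  by (simp add: ennreal_plus distrib_left)

text \<open>The symmetrized form is half the difference of the quadratic form at \<open>x + y\<close> and at
  \<open>x - y\<close>, so the parallelogram law gives the bound with no loss of a factor.\<close>

lemma A_inner_swap_bound:
  assumes A: "positive_op A" and T: "bounded_clinear T"
  shows "ennreal (cmod (A_inner A (T y) x + A_inner A (T x) y))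
    \<le> A_numerical_radius A T * ennreal ((A_norm A x)\<^sup>2 + (A_norm A y)\<^sup>2)"
proof -
  note lin = positive_op_bounded_clinear[OF A]
  define s where "s = A_inner A (T y) x + A_inner A (T x) y"
  have "2 * s = A_inner A (T (x + y)) (x + y) - A_inner A (T (x - y)) (x - y)"
    by (simp add: s_def bounded_clinear_add[OF T] bounded_clinear_diff[OF T]
        A_inner_add_left[OF lin] A_inner_diff_left[OF lin] A_inner_add_right A_inner_diff_right)
  then have "2 * cmod s
      \<le> cmod (A_inner A (T (x + y)) (x + y)) + cmod (A_inner A (T (x - y)) (x - y))"
    by (metis norm_mult norm_numeral norm_triangle_ineq4)
  then have "ennreal (2 * cmod s)
      \<le> A_numerical_radius A T * ennreal (2 * ((A_norm A x)\<^sup>2 + (A_norm A y)\<^sup>2))"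
    using A_numerical_radius_bound_pair[OF A T, of "x + y" "x - y"]
    unfolding A_norm_parallelogram[OF A]
    by (meson ennreal_leI order_trans)
  then have "2 * ennreal (cmod s)
      \<le> 2 * (A_numerical_radius A T * ennreal ((A_norm A x)\<^sup>2 + (A_norm A y)\<^sup>2))"
    by (simp add: ennreal_mult mult.left_commute del: ennreal_plus distrib_left_numeral)
  then show ?thesis
    unfolding s_def by (subst (asm) ennreal_mult_le_mult_iff) simp_all
qed

section \<open>The block operator\<close>

lemma A_inner_diag:
  "A_inner (block_op A (\<lambda>_. 0) (\<lambda>_. 0) A) (x, y) (u, v) = A_inner A x u + A_inner A y v"
  by (simp add: A_inner_def block_op_def cinner_prod_def)

theorem corollary4p2:
  fixes A T1 T2 :: "'a::chilbert_space \<Rightarrow> 'a"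
  assumes "positive_op A"
    and "T1 \<in> B_A A"
    and "T2 \<in> B_A A"
  shows "A_numerical_radius (block_op A (\<lambda>_. 0) (\<lambda>_. 0) A)
           (block_op T1 T2 T2 (\<lambda>x. (- \<i>) *\<^sub>C T1 x))
         \<le> A_numerical_radius A T1 + A_numerical_radius A T2"
  unfolding A_numerical_radius_def[of "block_op A _ _ A"]
proof (rule SUP_least)
  let ?AA = "block_op A (\<lambda>_. 0) (\<lambda>_. 0) A"
  let ?TT = "block_op T1 T2 T2 (\<lambda>x. (- \<i>) *\<^sub>C T1 x)"
  note A = assms(1) and T1 = B_A_bounded_clinear[OF assms(2)]
    and T2 = B_A_bounded_clinear[OF assms(3)]
  note lin = positive_op_bounded_clinear[OF A]
  fix p assume p: "p \<in> {p. A_norm ?AA p = 1}"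
  obtain x y where xy: "p = (x, y)" by (cases p)
  have unit: "(A_norm A x)\<^sup>2 + (A_norm A y)\<^sup>2 = 1"
    using p by (simp add: xy A_norm_def[of ?AA] A_inner_diag A_norm_sq[OF A])
  have "A_inner ?AA (?TT p) p = (A_inner A (T1 x) x - \<i> * A_inner A (T1 y) y)
      + (A_inner A (T2 y) x + A_inner A (T2 x) y)"
    unfolding xy block_op_def[of T1] prod.case A_inner_diag
    by (simp only: A_inner_add_left[OF lin] A_inner_scaleC_left[OF lin]) simp
  then have "cmod (A_inner ?AA (?TT p) p)
      \<le> (cmod (A_inner A (T1 x) x) + cmod (A_inner A (T1 y) y))
        + cmod (A_inner A (T2 y) x + A_inner A (T2 x) y)"
    using norm_triangle_ineq4[of "A_inner A (T1 x) x" "\<i> * A_inner A (T1 y) y"]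
    by (auto simp: norm_mult intro: order_trans[OF norm_triangle_ineq])
  then have "ennreal (cmod (A_inner ?AA (?TT p) p))
      \<le> ennreal (cmod (A_inner A (T1 x) x) + cmod (A_inner A (T1 y) y))
        + ennreal (cmod (A_inner A (T2 y) x + A_inner A (T2 x) y))"
    by (subst ennreal_plus[symmetric]) (auto intro: ennreal_leI simp del: ennreal_plus)
  also have "\<dots> \<le> A_numerical_radius A T1 + A_numerical_radius A T2"
    using A_numerical_radius_bound_pair[OF A T1, of x y] A_inner_swap_bound[OF A T2, where x = x and y = y]
    unfolding unit by (intro add_mono) simp_all
  finally show "ennreal (cmod (A_inner ?AA (?TT p) p))
      \<le> A_numerical_radius A T1 + A_numerical_radius A T2" .
qed

end
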